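(* Let $\pi/2\leq\delta<\pi$. If $f\in\mathcal{M}(\delta)$, then $$\log\left\{\frac{f(z)}{z}\right\}\prec\int_{0}^{z}\frac{\mathcal{B}_\delta(t)}{t}\,{\rm d}t\quad(z\in\Delta).$$ Moreover, the function $$\widetilde{\mathcal{B}}_\delta(z):=\int_{0}^{z}\frac{\mathcal{B}_\delta(t)}{t}\,{\rm d}t=\sum_{n=1}^{\infty}\frac{A_n}{n}z^n\quad(z\in\Delta)$$ is convex univalent in $\Delta$.
   Context: $\Delta=\{z\in\mathbb{C}:|z|<1\}$ is the open unit disc. $\mathcal{A}$ is the class of functions $f$ analytic in $\Delta$ with $f(0)=0$ and $f'(0)=1$. For $\pi/2\le\delta<\pi$, $\mathcal{M}(\delta)$ is the class of all $f\in\mathcal{A}$ such that $$1+\frac{\delta-\pi}{2\sin\delta}<\mathrm{Re}\left\{\frac{zf'(z)}{f(z)}\right\}<1+\frac{\delta}{2\sin\delta}\quad(z\in\Delta).$$ Here $zf'(z)/f(z)$ is analytic in $\Delta$ with value $1$ at $z=0$; in particular $f(z)\neq0$ for $z\in\Delta\setminus\{0\}$. For such $f$, $f(z)/z$ (with value $1$ at $z=0$) is analytic and zero-free in $\Delta$, and $\log\{f(z)/z\}$ denotes its analytic logarithm on $\Delta$ with value $0$ at $z=0$. The function $\mathcal{B}_\delta$ is defined on $\Delta$ by $$\mathcal{B}_\delta(z):=\frac{1}{2i\sin\delta}\log\left(\frac{1+ze^{i\delta}}{1+ze^{-i\delta}}\right),$$ with the branch of the logarithm that vanishes at $z=0$,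 and $$A_n=\frac{(-1)^{n-1}\sin n\delta}{n\sin\delta}\quad(n=1,2,\ldots).$$ Subordination: for $g,h$ analytic in $\Delta$, $g\prec h$ means that there is an analytic $\omega:\Delta\to\Delta$ with $\omega(0)=0$ and $g(z)=h(\omega(z))$ for all $z\in\Delta$. An analytic function on $\Delta$ is called convex univalent if it is injective on $\Delta$ and its image is a convex set. *)

theory Defs
  imports "HOL-Complex_Analysis.Complex_Analysis"
begin

abbreviation unit_disc :: "complex set"  (\<open>\<Delta>\<close>)
  where "\<Delta> \<equiv> ball 0 1"

definition class_A :: "(complex \<Rightarrow> complex) set" where
  "class_A = {f. f holomorphic_on \<Delta> \<and> f 0 = 0 \<and> deriv f 0 = 1}"

(* The analytic extension of z f'(z) / f(z) to z = 0. *)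
definition log_deriv_quot :: "(complex \<Rightarrow> complex) \<Rightarrow> complex \<Rightarrow> complex" where
  "log_deriv_quot f z = (if z = 0 then 1 else z * deriv f z / f z)"

(* Division by zero is total in HOL, so the absence of further zeros, i.e. analyticity of
   z f'(z) / f(z), has to be required explicitly. *)
definition class_M :: "real \<Rightarrow> (complex \<Rightarrow> complex) set" where
  "class_M \<delta> = {f \<in> class_A.
     (\<forall>z \<in> \<Delta> - {0}. f z \<noteq> 0) \<and>
     (\<forall>z \<in> \<Delta>. 1 + (\<delta> - pi) / (2 * sin \<delta>) < Re (log_deriv_quot f z) \<and>
               Re (log_deriv_quot f z) < 1 + \<delta> / (2 * sin \<delta>))}"

(* The branch of log g on the disc that vanishes at 0, for g analytic and zero-free with
   g 0 = 1. Only its values on the disc are determined: see disc_log_props and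
   disc_log_unique. *)
definition disc_log :: "(complex \<Rightarrow> complex) \<Rightarrow> complex \<Rightarrow> complex" where
  "disc_log g = (SOME L. L holomorphic_on \<Delta> \<and> L 0 = 0 \<and> (\<forall>z \<in> \<Delta>. exp (L z) = g z))"

definition quot_id :: "(complex \<Rightarrow> complex) \<Rightarrow> complex \<Rightarrow> complex" where
  "quot_id f z = (if z = 0 then 1 else f z / z)"

definition B_fun :: "real \<Rightarrow> complex \<Rightarrow> complex" where
  "B_fun \<delta> z = 1 / (2 * \<i> * of_real (sin \<delta>)) *
     disc_log (\<lambda>w. (1 + w * exp (\<i> * of_real \<delta>)) / (1 + w * exp (- (\<i> * of_real \<delta>)))) z"

definition A_coeff :: "real \<Rightarrow> nat \<Rightarrow> real" where
  "A_coeff \<delta> n = (-1) ^ (n - 1) * sin (real n * \<delta>) / (real n * sin \<delta>)"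

(* The integrand has a removable singularity at 0, so integrating along the segment from 0 to z
   gives the path-independent integral. *)
definition B_tilde :: "real \<Rightarrow> complex \<Rightarrow> complex" where
  "B_tilde \<delta> z = contour_integral (linepath 0 z) (\<lambda>t. B_fun \<delta> t / t)"

definition subordinate :: "(complex \<Rightarrow> complex) \<Rightarrow> (complex \<Rightarrow> complex) \<Rightarrow> bool"
    (infix \<open>\<prec>\<close> 50) where
  "g \<prec> h \<longleftrightarrow> g holomorphic_on \<Delta> \<and> h holomorphic_on \<Delta> \<and>
     (\<exists>\<omega>. \<omega> holomorphic_on \<Delta> \<and> \<omega> ` \<Delta> \<subseteq> \<Delta> \<and> \<omega> 0 = 0 \<and> (\<forall>z \<in> \<Delta>. g z = h (\<omega> z)))"

definition convex_univalent :: "(complex \<Rightarrow> complex) \<Rightarrow> bool" where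
  "convex_univalent h \<longleftrightarrow> h holomorphic_on \<Delta> \<and> inj_on h \<Delta> \<and> convex (h ` \<Delta>)"

lemma disc_log_exists:
  assumes "g holomorphic_on \<Delta>" "\<And>z. z \<in> \<Delta> \<Longrightarrow> g z \<noteq> 0" "g 0 = 1"
  shows "\<exists>L. L holomorphic_on \<Delta> \<and> L 0 = 0 \<and> (\<forall>z \<in> \<Delta>. exp (L z) = g z)"
proof -
  obtain K where K: "K holomorphic_on \<Delta>" "\<And>z. z \<in> \<Delta> \<Longrightarrow> g z = exp (K z)"
    using contractible_imp_holomorphic_log[OF assms(1) convex_imp_contractible[OF convex_ball] assms(2)]
    by blast
  have "exp (K 0) = 1" using K(2)[of 0] assms(3) by simp
  then have "(\<lambda>z. K z - K 0) holomorphic_on \<Delta> \<and> K 0 - K 0 = 0 \<and>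
      (\<forall>z \<in> \<Delta>. exp (K z - K 0) = g z)"
    using K by (auto intro!: holomorphic_intros simp: exp_diff)
  then show ?thesis by (intro exI[of _ "\<lambda>z. K z - K 0"]) auto
qed

lemma disc_log_props:
  assumes "g holomorphic_on \<Delta>" "\<And>z. z \<in> \<Delta> \<Longrightarrow> g z \<noteq> 0" "g 0 = 1"
  shows "disc_log g holomorphic_on \<Delta>" "disc_log g 0 = 0"
    "\<And>z. z \<in> \<Delta> \<Longrightarrow> exp (disc_log g z) = g z"
  using someI_ex[OF disc_log_exists[OF assms]] unfolding disc_log_def by auto

lemma disc_log_unique:
  assumes L: "L holomorphic_on \<Delta>" "L 0 = 0" "\<And>z. z \<in> \<Delta> \<Longrightarrow> exp (L z) = g z"
    and z: "z \<in> \<Delta>"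
  shows "disc_log g z = L z"
proof -
  define M where "M = disc_log g"
  have M: "M holomorphic_on \<Delta>" "M 0 = 0" "\<And>z. z \<in> \<Delta> \<Longrightarrow> exp (M z) = g z"
    using someI_ex[of "\<lambda>L. L holomorphic_on \<Delta> \<and> L 0 = 0 \<and> (\<forall>z \<in> \<Delta>. exp (L z) = g z)"] L
    unfolding M_def disc_log_def by blast+
  define D where "D = (\<lambda>z. M z - L z)"
  have D: "D holomorphic_on \<Delta>" unfolding D_def by (intro holomorphic_intros M L)
  have e: "exp (D w) = 1" if "w \<in> \<Delta>" for w
    using L(3)[OF that] M(3)[OF that] by (simp add: D_def exp_diff flip: L(3)[OF that])
  have "(D has_field_derivative 0) (at w)" if w: "w \<in> \<Delta>" for w
  proof -
    have d: "(D has_field_derivative deriv D w) (at w)"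
      using D w holomorphic_derivI by blast
    then have "((\<lambda>z. exp (D z)) has_field_derivative exp (D w) * deriv D w) (at w)"
      by (auto intro!: derivative_eq_intros)
    moreover have "((\<lambda>z. exp (D z)) has_field_derivative 0) (at w)"
      by (rule has_field_derivative_transform_within_open[where f = "\<lambda>_. 1" and S = "\<Delta>"])
        (use w e in auto)
    ultimately have "deriv D w = 0" using DERIV_unique by fastforce
    then show ?thesis using d by simp
  qed
  then obtain c where "\<And>w. w \<in> \<Delta> \<Longrightarrow> D w = c"
    using has_field_derivative_zero_constant[of "\<Delta>" D]
    by (metis convex_ball has_field_derivative_at_within)
  then have "D z = D 0" using z by simp
  then show ?thesis using M(2) L(2) by (simp add: D_def M_def)
qed

end

theory Submission
  imports Defs
begin

text \<open>The function B maps the disc bijectively onto the vertical strip S given by the defining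
  inequalities of the class M shifted by -1, with inverse w \<mapsto> sin (s w) / sin (\<delta> - s w), s = sin \<delta>;
  and z q'(z) = B(z) for q the integral of B(t)/t. Membership of f in M says that p = log (f(z)/z) has
  z p'(z) in S. Since S is convex and contains 0, Jack's lemma yields p \<prec> q
  whenever q is univalent, and convexity of q(\<Delta>) follows by applying this to convex
  combinations of rotated and shrunk copies of q. Univalence of q holds because Re (B(z)/z) > 0: with
  u = s B(z) one has B(z)/z = u cot u - u cot \<delta>, whose real part is positive on the strip.\<close>

section \<open>Jack's lemma, and the criteria for subordination and convexity\<close>

text \<open>Jack's lemma, normalised to the boundary point 1. By Schwarz, |h (1 + t d)| \<le> |1 + t d| for
  every inward direction d and small t > 0; comparing first-order terms gives Re (c d) \<le> Re d, and
  letting d run through the half-plane Re d < 0 pins down c.\<close>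

lemma Jack_lemma:
  fixes h :: "complex \<Rightarrow> complex"
  assumes hol: "h holomorphic_on \<Delta>" and h0: "h 0 = 0"
    and less: "\<And>z. norm z < 1 \<Longrightarrow> norm (h z) < 1"
    and der: "(h has_field_derivative c) (at 1)" and h1: "h 1 = 1"
  shows "Im c = 0" "1 \<le> Re c"
proof -
  have inward: "Re (c * d) \<le> Re d" if d: "Re d < 0" for d
  proof -
    \<comment> \<open>If |1 + t d|^2 = 1 + x, then |1 + t d| <= 1 + x/2; the first three terms are
      this bound. Hence \<open>k\<close> is nonnegative for small t > 0 and zero at 0, which forbids
      a negative derivative at 0.\<close>
    define k where "k = (\<lambda>t::real. 1 + t * Re d + t^2 * (norm d)^2 / 2 - Re (h (1 + of_real t * d)))"
    have "((\<lambda>t. h (1 + of_real t * d)) has_vector_derivative d * c) (at 0)"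
    proof -
      have "((\<lambda>t::real. 1 + of_real t * d) has_vector_derivative d) (at 0)"
        by (auto intro!: derivative_eq_intros simp: has_vector_derivative_def scaleR_conv_of_real)
      moreover have "(h has_field_derivative c) (at (1 + of_real 0 * d))"
        using der by simp
      ultimately show ?thesis
        using field_vector_diff_chain_at[of "\<lambda>t. 1 + of_real t * d" d 0 h c] by (simp add: o_def)
    qed
    then have "((\<lambda>t. Re (h (1 + of_real t * d))) has_vector_derivative Re (d * c)) (at 0)"
      by (rule bounded_linear.has_vector_derivative[OF bounded_linear_Re])
    then have "((\<lambda>t. Re (h (1 + of_real t * d))) has_real_derivative Re (d * c)) (at 0)"
      by (simp only: has_real_derivative_iff_has_vector_derivative)
    moreover have "((\<lambda>t::real. 1 + t * Re d + t^2 * (norm d)^2 / 2) has_real_derivative Re d) (at 0)"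
      by (auto intro!: derivative_eq_intros)
    ultimately have kd: "(k has_real_derivative (Re d - Re (d * c))) (at 0)"
      unfolding k_def by (rule DERIV_diff[rotated])
    have d0: "norm d > 0" using d by auto
    \<comment> \<open>For t > 0 the upper limit on t says exactly that |1 + t d| < 1.\<close>
    have k0: "0 \<le> k t" if t: "0 < t" "t < - 2 * Re d / (norm d)^2" for t
    proof -
      have "t * (norm d)^2 < - 2 * Re d" using t d0 by (simp add: field_simps)
      then have "t * (t * (norm d)^2) < t * (- 2 * Re d)" using t(1) by (rule mult_strict_left_mono)
      then have small: "2 * t * Re d + t^2 * (norm d)^2 < 0" by (simp add: power2_eq_square algebra_simps)
      have sq: "(norm (1 + of_real t * d))^2 = 1 + (2 * t * Re d + t^2 * (norm d)^2)"
        unfolding cmod_power2 by (simp add: power2_eq_square algebra_simps)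
      have "(norm (1 + of_real t * d))^2 < 1^2" using sq small by simp
      then have "norm (1 + of_real t * d) < 1" by (rule power2_less_imp_less) simp
      then have "norm (h (1 + of_real t * d)) \<le> norm (1 + of_real t * d)"
        using Schwarz_Lemma(1)[OF hol h0 less] by blast
      moreover have "norm (1 + of_real t * d) \<le> 1 + (2 * t * Re d + t^2 * (norm d)^2) / 2"
      proof -
        have "0 \<le> (norm (1 + of_real t * d) - 1)^2" by simp
        then show ?thesis unfolding power2_diff sq by (simp add: add_divide_distrib)
      qed
      moreover have "Re (h (1 + of_real t * d)) \<le> norm (h (1 + of_real t * d))" by (rule complex_Re_le_cmod)
      ultimately show ?thesis unfolding k_def by (simp add: field_simps)
    qed
    show ?thesis
    proof (rule ccontr)
      assume "\<not> ?thesis"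
      then have "Re d - Re (d * c) < 0" by (simp add: mult.commute)
      from DERIV_neg_dec_right[OF kd this] obtain e where e: "0 < e"
        "\<And>t. 0 < t \<Longrightarrow> t < e \<Longrightarrow> k (0 + t) < k 0" by blast
      define t where "t = min e (- 2 * Re d / (norm d)^2) / 2"
      have "- 2 * Re d / (norm d)^2 > 0" using d d0 by (intro divide_pos_pos) auto
      then have t: "0 < t" "t < e" "t < - 2 * Re d / (norm d)^2" using e(1) by (auto simp: t_def min_def)
      have "k 0 = 0" using h1 by (simp add: k_def)
      then show False using e(2)[OF t(1,2)] k0[OF t(1,3)] by simp
    qed
  qed
  have *: "1 \<le> Re c + T * Im c" for T
    using inward[of "Complex (-1) T"] by (simp add: algebra_simps)
  show "1 \<le> Re c" using *[of 0] by simp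
  show "Im c = 0"
  proof (rule ccontr)
    assume "Im c \<noteq> 0"
    then show False using *[of "- Re c / Im c"] by simp
  qed
qed

text \<open>Suffridge's argument. If p (ball 0 r) is not contained in q (ball 0 r), take a point a of least
  modulus violating this and let v be the preimage of p a under q, so that |v| = r > |a|. Jack's lemma
  gives a p'(a) = m v q'(v) with m \<ge> 1, hence v = \<phi> (a p'(a) / m). But
  \<phi> (\<tau> z p'(z)) is a self-map of the disc fixing 0 for every \<tau> in [0,1], so
  |v| \<le> |a| by Schwarz.\<close>

lemma subordinate_of_log_derivative:
  fixes p q \<phi> :: "complex \<Rightarrow> complex"
  assumes S: "convex S" "0 \<in> S"
    and \<phi>: "\<phi> holomorphic_on S" "\<phi> ` S \<subseteq> \<Delta>" "\<phi> 0 = 0"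
    and q: "q holomorphic_on \<Delta>" "inj_on q \<Delta>" "q 0 = 0"
    and \<phi>q: "\<And>z. z \<in> \<Delta> \<Longrightarrow> \<phi> (z * deriv q z) = z"
    and p: "p holomorphic_on \<Delta>" "p 0 = 0" "\<And>z. z \<in> \<Delta> \<Longrightarrow> z * deriv p z \<in> S"
  shows "p \<prec> q"
proof -
  obtain g where g: "g holomorphic_on (q ` \<Delta>)" "\<And>z. z \<in> \<Delta> \<Longrightarrow> deriv q z * deriv g (q z) = 1"
    "\<And>z. z \<in> \<Delta> \<Longrightarrow> g (q z) = z"
    using holomorphic_has_inverse[OF q(1) _ q(2)] by (metis open_ball)
  have contp: "continuous_on \<Delta> p" and contq: "continuous_on \<Delta> q"
    using p(1) q(1) holomorphic_on_imp_continuous_on by blast+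
  have openq: "open (q ` A)" if "open A" "A \<subseteq> \<Delta>" for A
    using open_mapping_thm3[OF holomorphic_on_subset[OF q(1) that(2)] that(1) inj_on_subset[OF q(2) that(2)]] .
  have Schwarz: "norm (\<phi> (of_real \<tau> * (a * deriv p a))) \<le> norm a"
    if \<tau>: "0 \<le> \<tau>" "\<tau> \<le> 1" and a: "a \<in> \<Delta>" for \<tau> a
  proof -
    have mem: "of_real \<tau> * (z * deriv p z) \<in> S" if "z \<in> \<Delta>" for z
      using convexD[OF S(1) p(3)[OF that] S(2), of \<tau> "1 - \<tau>"] \<tau> by (simp add: scaleR_conv_of_real)
    have "(\<lambda>z. of_real \<tau> * (z * deriv p z)) holomorphic_on \<Delta>"
      by (intro holomorphic_intros holomorphic_deriv p(1)) auto
    then have "(\<phi> \<circ> (\<lambda>z. of_real \<tau> * (z * deriv p z))) holomorphic_on \<Delta>"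
      by (rule holomorphic_on_compose_gen[OF _ \<phi>(1)]) (use mem in auto)
    from Schwarz_Lemma(1)[OF this, of a] show ?thesis
      using mem \<phi>(2,3) a by (auto simp: image_subset_iff)
  qed
  have sub: "p ` ball 0 r \<subseteq> q ` ball 0 r" if r: "0 < r" "r < 1" for r
  proof (rule ccontr)
    assume "\<not> ?thesis"
    then obtain b where b: "norm b < r" "p b \<notin> q ` ball 0 r" by (meson image_subsetI mem_ball_0)
    \<comment> \<open>The violations inside a closed ball. The image of \<open>ball 0 r\<close>
      under \<open>q\<close> is open, so \<open>K\<close> is compact and has a point of least
      modulus.\<close>
    define K where "K = cball 0 (norm b) \<inter> p -` (- q ` ball 0 r)"
    have "open (q ` ball 0 r)" by (rule openq) (use r in auto)
    then have "closed K"
      unfolding K_def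
      by (intro continuous_closed_preimage continuous_on_subset[OF contp]) (use b r in auto)
    then have "compact K" unfolding K_def
      by (metis Int_lower1 bounded_cball bounded_subset compact_eq_bounded_closed)
    moreover have "K \<noteq> {}" using b by (auto simp: K_def)
    ultimately obtain a where a: "a \<in> K" "\<And>z. z \<in> K \<Longrightarrow> norm a \<le> norm z"
      using continuous_attains_inf[of K norm] continuous_on_norm_id by blast
    have anorm: "norm a < r" "p a \<notin> q ` ball 0 r" using a(1) b(1) by (auto simp: K_def)
    have a0: "a \<noteq> 0" using anorm p(2) q(3) r by force
    have a\<Delta>: "a \<in> \<Delta>" using anorm r by simp
    have inside: "p z \<in> q ` ball 0 r" if "norm z < norm a" for z
      using a(2)[of z] that a(1) by (force simp: K_def)
    \<comment> \<open>By minimality \<open>p\<close> maps the open ball of radius |a| into the image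
      of \<open>ball 0 r\<close>, so by continuity \<open>p a\<close> lies in the compact image of
      \<open>cball 0 r\<close>. As it avoids the open image, its preimage has modulus exactly
      r.\<close>
    have "p a \<in> q ` cball 0 r"
    proof -
      have "compact (q ` cball 0 r)"
        by (rule compact_continuous_image[OF continuous_on_subset[OF contq]]) (use r in auto)
      then have cl: "closed (q ` cball 0 r)" by (rule compact_imp_closed)
      have "p ` closure (ball 0 (norm a)) \<subseteq> q ` cball 0 r"
      proof (rule image_closure_subset)
        show "continuous_on (closure (ball 0 (norm a))) p"
          by (rule continuous_on_subset[OF contp]) (use a0 a\<Delta> in auto)
        show "p ` ball 0 (norm a) \<subseteq> q ` cball 0 r" using inside by fastforce
      qed (rule cl)
      then show ?thesis using a0 by auto
    qed
    then obtain v where v: "p a = q v" "norm v \<le> r" by auto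
    have nv: "norm v = r" using v anorm(2) by (metis imageI le_less mem_ball_0)
    have v\<Delta>: "v \<in> \<Delta>" and v0: "v \<noteq> 0" using nv r by auto
    define \<omega> where "\<omega> = (\<lambda>z. g (p z))"
    have \<omega>a: "\<omega> a = v" using v(1) g(3)[OF v\<Delta>] by (simp add: \<omega>_def)
    have \<omega>in: "norm (\<omega> z) < r" if z: "norm z < norm a" for z
      using inside[OF z] g(3) r by (auto simp: \<omega>_def)
    have dp: "(p has_field_derivative deriv p a) (at a)"
      using p(1) a\<Delta> holomorphic_derivI by blast
    have dg: "(g has_field_derivative deriv g (q v)) (at (p a))"
      using holomorphic_derivI[OF g(1) openq[OF open_ball order_refl] imageI[OF v\<Delta>]] v(1) by simp
    have d\<omega>: "(\<omega> has_field_derivative deriv g (q v) * deriv p a) (at a)"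
      unfolding \<omega>_def by (rule DERIV_chain2[OF dg dp])
    \<comment> \<open>Rescaling moves both a and v to 1, the configuration that
      \<open>Jack_lemma\<close> expects.\<close>
    define h where "h = (\<lambda>z. \<omega> (a * z) / v)"
    define c where "c = a * (deriv g (q v) * deriv p a) / v"
    have small: "norm (a * z) < norm a" if "norm z < 1" for z
      using that a0 by (simp add: norm_mult)
    have "\<omega> holomorphic_on ball 0 (norm a)"
      unfolding \<omega>_def
    proof (rule holomorphic_on_compose_gen[OF _ g(1), unfolded o_def])
      show "p holomorphic_on ball 0 (norm a)" by (rule holomorphic_on_subset[OF p(1)]) (use a\<Delta> in auto)
      show "p ` ball 0 (norm a) \<subseteq> q ` \<Delta>" using inside r by fastforce
    qed
    then have "(\<omega> \<circ> (\<lambda>z. a * z)) holomorphic_on \<Delta>"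
      by (intro holomorphic_on_compose_gen[where g = \<omega>]) (use small in \<open>auto intro!: holomorphic_intros\<close>)
    then have h1: "h holomorphic_on \<Delta>"
      unfolding h_def o_def by (intro holomorphic_intros) (use v0 in auto)
    have h2: "h 0 = 0" using g(3)[of 0] p(2) q(3) by (simp add: h_def \<omega>_def)
    have h3: "norm (h z) < 1" if "norm z < 1" for z
      using \<omega>in[OF small[OF that]] nv r by (simp add: h_def norm_divide)
    have h4: "(h has_field_derivative c) (at 1)"
      unfolding h_def c_def using d\<omega> v0
      by (auto intro!: derivative_eq_intros DERIV_chain2[where f = \<omega>])
    have h5: "h 1 = 1" using \<omega>a v0 by (simp add: h_def)
    note J = Jack_lemma[OF h1 h2 h3 h4 h5]
    define m where "m = Re c"
    have cm: "c = of_real m" "1 \<le> m" using J by (auto simp: m_def complex_eq_iff)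
    \<comment> \<open>\<open>deriv g (q v)\<close> is the reciprocal of \<open>deriv q v\<close>, so
      c = m is a relation between a p'(a) and v q'(v).\<close>
    have "a * deriv p a = of_real m * (v * deriv q v)"
    proof -
      have "of_real m * (v * deriv q v) = a * deriv p a * (deriv q v * deriv g (q v))"
        using v0 unfolding cm(1)[symmetric] c_def by simp
      then show ?thesis using g(2)[OF v\<Delta>] by simp
    qed
    then have "v * deriv q v = of_real (1 / m) * (a * deriv p a)" using cm(2) by simp
    then have "v = \<phi> (of_real (1 / m) * (a * deriv p a))" using \<phi>q[OF v\<Delta>] by simp
    then have "norm v \<le> norm a" using Schwarz[of "1 / m" a] cm(2) a\<Delta> by simp
    then show False using nv anorm by simp
  qed
  have range: "p z \<in> q ` \<Delta>" if z: "z \<in> \<Delta>" for z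
  proof -
    obtain r where r: "norm z < r" "r < 1" using z dense by auto
    have "0 < r" using r norm_ge_zero[of z] by linarith
    from sub[OF this r(2)] r show ?thesis by fastforce
  qed
  show ?thesis unfolding subordinate_def
  proof (intro conjI p(1) q(1) exI[of _ "\<lambda>z. g (p z)"] ballI)
    show "(\<lambda>z. g (p z)) holomorphic_on \<Delta>"
      by (rule holomorphic_on_compose_gen[OF p(1) g(1), unfolded o_def]) (use range in auto)
    show "(\<lambda>z. g (p z)) ` \<Delta> \<subseteq> \<Delta>" using range g(3) by fastforce
    show "g (p 0) = 0" using g(3)[of 0] p(2) q(3) by simp
    show "p z = q (g (p z))" if "z \<in> \<Delta>" for z using range[OF that] g(3) by fastforce
  qed
qed

text \<open>For |x| \<le> |y|, the point s q(x) + t q(y) is the value at y of the function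
  s q(z x / y) + t q(z), which is subordinate to q by the previous lemma.\<close>

lemma convex_image_of_log_derivative:
  fixes q \<phi> :: "complex \<Rightarrow> complex"
  assumes S: "convex S" "0 \<in> S"
    and \<phi>: "\<phi> holomorphic_on S" "\<phi> ` S \<subseteq> \<Delta>" "\<phi> 0 = 0"
    and q: "q holomorphic_on \<Delta>" "inj_on q \<Delta>" "q 0 = 0"
    and \<phi>q: "\<And>z. z \<in> \<Delta> \<Longrightarrow> \<phi> (z * deriv q z) = z"
    and qS: "\<And>z. z \<in> \<Delta> \<Longrightarrow> z * deriv q z \<in> S"
  shows "convex (q ` \<Delta>)"
proof -
  have *: "of_real s * q x + of_real t * q y \<in> q ` \<Delta>"
    if xy: "x \<in> \<Delta>" "y \<in> \<Delta>" "norm x \<le> norm y" and st: "0 \<le> s" "0 \<le> t" "s + t = 1" for x y s t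
  proof (cases "y = 0")
    case True
    then show ?thesis using xy q(3) by force
  next
    case False
    define k where "k = x / y"
    have k: "norm k \<le> 1" using xy False by (simp add: k_def norm_divide)
    have kz: "z * k \<in> \<Delta>" if "z \<in> \<Delta>" for z
      using that k mult_left_le[of "norm k" "norm z"] by (simp add: norm_mult)
    define p where "p = (\<lambda>z. of_real s * q (z * k) + of_real t * q z)"
    have dp: "(p has_field_derivative (of_real s * (deriv q (z * k) * k) + of_real t * deriv q z)) (at z)"
      if z: "z \<in> \<Delta>" for z
    proof -
      have "((\<lambda>z. q (z * k)) has_field_derivative (deriv q (z * k) * k)) (at z)"
        by (rule DERIV_chain2[where f = q and g = "\<lambda>z. z * k"])
          (use holomorphic_derivI[OF q(1) open_ball kz[OF z]] in \<open>auto intro!: derivative_eq_intros\<close>)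
      then show ?thesis
        unfolding p_def using holomorphic_derivI[OF q(1) open_ball z]
        by (auto intro!: derivative_eq_intros)
    qed
    have "p \<prec> q"
    proof (rule subordinate_of_log_derivative[OF S \<phi> q \<phi>q])
      show "p holomorphic_on \<Delta>" using dp holomorphic_on_open[OF open_ball] by blast
      show "p 0 = 0" using q(3) by (simp add: p_def)
      show "z * deriv p z \<in> S" if z: "z \<in> \<Delta>" for z
      proof -
        \<comment> \<open>The operator z d/dz commutes with replacing z by z * k, so the result is a
          convex combination of two values of w q'(w).\<close>
        have "z * deriv p z = s *\<^sub>R (z * k * deriv q (z * k)) + t *\<^sub>R (z * deriv q z)"
          using DERIV_imp_deriv[OF dp[OF z]] by (simp add: scaleR_conv_of_real algebra_simps)
        then show ?thesis using convexD[OF S(1) qS[OF kz[OF z]] qS[OF z] st] by simp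
      qed
    qed
    then have "p y \<in> q ` \<Delta>" using xy(2) unfolding subordinate_def by fastforce
    then show ?thesis using False by (simp add: p_def k_def)
  qed
  show ?thesis
  proof (rule convexI)
    fix X Y :: complex and s t :: real
    assume X: "X \<in> q ` \<Delta>" and Y: "Y \<in> q ` \<Delta>" and st: "0 \<le> s" "0 \<le> t" "s + t = 1"
    from X Y obtain x y where xy: "x \<in> \<Delta>" "y \<in> \<Delta>" "X = q x" "Y = q y" by blast
    show "s *\<^sub>R X + t *\<^sub>R Y \<in> q ` \<Delta>"
    proof (cases "norm x \<le> norm y")
      case True
      then show ?thesis using *[OF xy(1,2) _ st] xy by (simp add: scaleR_conv_of_real)
    next
      case False
      then show ?thesis using *[OF xy(2,1) _ st(2,1)] st(3) xy by (simp add: scaleR_conv_of_real add.commute)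
    qed
  qed
qed

section \<open>Univalence criterion and real inequalities\<close>

text \<open>If f x = f y, the mean value theorem for Re (f / (y - x)) on the segment gives a point
  where Re f' = 0: the division cancels the direction y - x of the segment.\<close>

lemma Noshiro_Warschawski:
  assumes A: "convex A" and der: "\<And>z. z \<in> A \<Longrightarrow> (f has_field_derivative f' z) (at z)"
    and pos: "\<And>z. z \<in> A \<Longrightarrow> 0 < Re (f' z)"
  shows "inj_on f A"
proof (rule inj_onI, rule ccontr)
  fix x y assume xy: "x \<in> A" "y \<in> A" "f x = f y" "x \<noteq> y"
  have seg: "closed_segment x y \<subseteq> A" using xy A by (simp add: closed_segment_subset)
  have "\<exists>u. u \<in> closed_segment x y \<and>
      Re (f y / (y - x)) - Re (f x / (y - x)) = Re (f' u / (y - x) * (y - x))"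
    by (rule complex_mvt_line) (use der seg in \<open>auto intro!: DERIV_cdivide\<close>)
  then obtain u where u: "u \<in> closed_segment x y" "Re (f' u / (y - x) * (y - x)) = 0"
    using xy by auto
  then show False using pos[of u] seg xy by auto
qed

text \<open>The mean value theorem gives sin x = x cos y with 0 < y < x, and cosine decreases on
  [0, pi].\<close>

lemma mult_cos_le_sin:
  fixes x :: real
  assumes "0 \<le> x" "x \<le> pi"
  shows "x * cos x \<le> sin x"
proof (cases "x = 0")
  case False
  then have "0 < x" using assms by simp
  then obtain y where y: "0 < y" "y < x" "sin x - sin 0 = (x - 0) * cos y"
    using MVT2[of 0 x sin cos] DERIV_sin by blast
  have "cos x \<le> cos y" by (rule cos_monotone_0_pi_le) (use y assms in auto)
  then show ?thesis using y(3) assms(1) by (simp add: mult_left_mono)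
qed simp

text \<open>For x > 0 this is the mean value theorem for cosh and monotonicity of sinh; both sides
  are even in x.\<close>

lemma cosh_le_one_plus_mult_sinh: "cosh x \<le> 1 + x * sinh (x::real)"
proof -
  have pos: "cosh x \<le> 1 + x * sinh x" if "0 < x" for x :: real
  proof -
    obtain y where y: "0 < y" "y < x" "cosh x - cosh 0 = (x - 0) * sinh y"
      using MVT2[of 0 x cosh sinh] \<open>0 < x\<close> has_field_derivative_cosh[OF DERIV_ident] by auto
    have "x * sinh y \<le> x * sinh x" using y that by (intro mult_left_mono) auto
    then show ?thesis using y(3) by simp
  qed
  show ?thesis using pos[of x] pos[of "- x"] by (cases x "0 :: real" rule: linorder_cases) auto
qed

text \<open>With u = (a + i b)/2 the expression below is, up to a positive factor, the real part of
  u (cot u - cot \<delta>).\<close>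

lemma strip_positivity:
  fixes \<delta> a b :: real
  assumes \<delta>: "pi / 2 \<le> \<delta>" "\<delta> < pi" and a: "\<delta> - pi < a" "a < \<delta>" and ne: "a \<noteq> 0 \<or> b \<noteq> 0"
  shows "0 < a * (cos (\<delta> - a) - cos \<delta> * cosh b) + b * sinh b * sin \<delta>"
proof -
  have s: "0 < sin \<delta>" using \<delta> by (intro sin_gt_zero) auto
  have c: "cos \<delta> \<le> 0" using cos_monotone_0_pi_le[of "pi/2" \<delta>] \<delta> by simp
  have bs: "0 \<le> b * sinh b" by (cases "0 \<le> b") (auto intro: mult_nonneg_nonneg mult_nonpos_nonpos)
  consider "a = 0" | "0 < a" | "a < 0" by linarith
  then show ?thesis
  proof cases
    case 1
    then have "b \<noteq> 0" using ne by simp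
    then have "b * sinh b \<noteq> 0" by simp
    then have "0 < b * sinh b" using bs by linarith
    then show ?thesis using 1 s by simp
  next
    case 2
    have "cos \<delta> < cos (\<delta> - a)" by (rule cos_monotone_0_pi) (use 2 a \<delta> in auto)
    moreover have "cos \<delta> * cosh b \<le> cos \<delta> * 1"
      by (rule mult_left_mono_neg) (use c cosh_real_ge_1[of b] in auto)
    ultimately have "0 < cos (\<delta> - a) - cos \<delta> * cosh b" by simp
    then show ?thesis using 2 bs s by (intro add_pos_nonneg) auto
  next
    case 3
    \<comment> \<open>After reflection the claim is 0 < k (cos (g - k) - cos g cosh b) + b sinh b
      sin g. Since k cos g <= sin g, the last term is at least k cos g b sinh b, and cosh b - b sinh
      b <= 1 leaves k (cos (g - k) - cos g) > 0.\<close>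
    define k where "k = - a"
    define g where "g = pi - \<delta>"
    have k: "0 < k" "k < g" and g: "0 < g" "g \<le> pi / 2" using 3 a \<delta> by (auto simp: k_def g_def)
    have cg: "0 \<le> cos g" using g by (intro cos_ge_zero) auto
    have e: "sin \<delta> = sin g" "cos \<delta> = - cos g" by (auto simp: g_def)
    have "\<delta> - a = pi - (g - k)" by (simp add: g_def k_def)
    then have e': "cos (\<delta> - a) = - cos (g - k)" by simp
    have "k * cos g \<le> g * cos g" using k cg by (intro mult_right_mono) auto
    also have "\<dots> \<le> sin g" using mult_cos_le_sin[of g] g by simp
    finally have "b * sinh b * (k * cos g) \<le> b * sinh b * sin g" using bs by (rule mult_left_mono)
    moreover have "cos g * (cosh b - b * sinh b) \<le> cos g * 1"
      using cosh_le_one_plus_mult_sinh[of b] cg by (intro mult_left_mono) auto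
    moreover have "cos g < cos (g - k)" by (rule cos_monotone_0_pi) (use k g in auto)
    ultimately have "0 < k * (cos (g - k) - cos g * (cosh b - b * sinh b))"
      "b * sinh b * (k * cos g) \<le> b * sinh b * sin g" using k by auto
    then show ?thesis unfolding e e' using k_def by (simp add: algebra_simps)
  qed
qed

section \<open>The strip and its map into the disc\<close>

text \<open>|sin u|^2 = (cosh (2 Im u) - cos (2 Re u)) / 2. The points u and \<delta> - u have
  opposite imaginary parts, so the cosh terms cancel in the difference of the squares.\<close>

lemma norm_sin_less_iff:
  "norm (sin u) < norm (sin (of_real \<delta> - u)) \<longleftrightarrow> 0 < sin \<delta> * sin (\<delta> - 2 * Re u)"
proof -
  have "cos (2 * Re u) - cos (2 * (\<delta> - Re u)) = 2 * (sin \<delta> * sin (\<delta> - 2 * Re u))"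
    using cos_diff_cos[of "2 * Re u" "2 * (\<delta> - Re u)"]
    by (simp add: diff_divide_distrib algebra_simps)
  then have "(norm (sin (of_real \<delta> - u)))^2 - (norm (sin u))^2 = sin \<delta> * sin (\<delta> - 2 * Re u)"
    unfolding norm_sin_squared by (simp add: exp_minus field_simps)
  then show ?thesis
    by (smt (verit, best) norm_ge_zero power_less_imp_less_base power_strict_mono zero_less_numeral)
qed

definition strip :: "real \<Rightarrow> complex set" where
  "strip \<delta> = {w. (\<delta> - pi) / (2 * sin \<delta>) < Re w \<and> Re w < \<delta> / (2 * sin \<delta>)}"

text \<open>With u = sin \<delta> * w, this is the solution z of (1 + z e^(i \<delta>)) / (1 + z
  e^(-i \<delta>)) = e^(2 i u).\<close>

definition strip_map :: "real \<Rightarrow> complex \<Rightarrow> complex" where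
  "strip_map \<delta> w = sin (of_real (sin \<delta>) * w) / sin (of_real \<delta> - of_real (sin \<delta>) * w)"

lemma mem_strip_iff:
  assumes "0 < sin \<delta>"
  shows "w \<in> strip \<delta> \<longleftrightarrow>
    \<delta> - pi < 2 * Re (of_real (sin \<delta>) * w) \<and> 2 * Re (of_real (sin \<delta>) * w) < \<delta>"
  using assms by (auto simp: strip_def field_simps)

lemma convex_strip: "convex (strip \<delta>)"
proof -
  have "strip \<delta> = {w. inner 1 w > (\<delta> - pi) / (2 * sin \<delta>)} \<inter> {w. inner 1 w < \<delta> / (2 * sin \<delta>)}"
    by (auto simp: strip_def inner_complex_def)
  then show ?thesis by (simp only: convex_Int convex_halfspace_lt convex_halfspace_gt)
qed

lemma zero_mem_strip: "0 < \<delta> \<Longrightarrow> \<delta> < pi \<Longrightarrow> 0 \<in> strip \<delta>"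
  by (subst mem_strip_iff) (auto intro: sin_gt_zero)

text \<open>The strip is where \<delta> - 2 Re u lies in (0, pi), so both sines in
  \<open>norm_sin_less_iff\<close> are positive. This bounds \<open>strip_map\<close> by 1 and keeps
  its denominator nonzero.\<close>

lemma norm_sin_less_strip:
  assumes "0 < \<delta>" "\<delta> < pi" "w \<in> strip \<delta>"
  shows "norm (sin (of_real (sin \<delta>) * w)) < norm (sin (of_real \<delta> - of_real (sin \<delta>) * w))"
proof -
  have s: "0 < sin \<delta>" using assms by (intro sin_gt_zero) auto
  then show ?thesis unfolding norm_sin_less_iff
    using assms(3) by (intro mult_pos_pos sin_gt_zero) (auto simp: mem_strip_iff[OF s] assms)
qed

lemma strip_map_props:
  assumes "0 < \<delta>" "\<delta> < pi"
  shows "strip_map \<delta> holomorphic_on strip \<delta>" "strip_map \<delta> ` strip \<delta> \<subseteq> \<Delta>" "strip_map \<delta> 0 = 0"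
proof -
  note less = norm_sin_less_strip[OF assms]
  have nz: "sin (of_real \<delta> - of_real (sin \<delta>) * w) \<noteq> 0" if "w \<in> strip \<delta>" for w
    using less[OF that] by auto
  show "strip_map \<delta> holomorphic_on strip \<delta>"
    unfolding strip_map_def by (intro holomorphic_intros) (use nz in auto)
  show "strip_map \<delta> ` strip \<delta> \<subseteq> \<Delta>"
    using less nz by (auto simp: strip_map_def norm_divide divide_less_eq)
  show "strip_map \<delta> 0 = 0" by (simp add: strip_map_def)
qed

section \<open>The function \<open>B_fun\<close>: logarithms, range and power series\<close>

text \<open>Numerator and denominator both have positive real part on the disc, so the difference of
  their principal logarithms is holomorphic there and vanishes at 0; \<open>disc_log_unique\<close>
  identifies it with the chosen branch.\<close>

lemma B_fun_eq:
  assumes z: "z \<in> \<Delta>"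
  shows "B_fun \<delta> z = (Ln (1 + z * exp (\<i> * of_real \<delta>)) - Ln (1 + z * exp (- (\<i> * of_real \<delta>))))
    / (2 * \<i> * of_real (sin \<delta>))"
proof -
  have pos: "0 < Re (1 + w * exp (\<i> * of_real t))" if "w \<in> \<Delta>" for w t
    using abs_Re_le_cmod[of "w * exp (\<i> * of_real t)"] that by (simp add: norm_mult)
  have pos': "0 < Re (1 + w * exp (- (\<i> * of_real t)))" if "w \<in> \<Delta>" for w t
    using pos[OF that, of "- t"] by simp
  have np: "1 + w * exp (\<i> * of_real \<delta>) \<notin> \<real>\<^sub>\<le>\<^sub>0" "1 + w * exp (- (\<i> * of_real \<delta>)) \<notin> \<real>\<^sub>\<le>\<^sub>0"
    if "w \<in> \<Delta>" for w
    using pos[OF that, of \<delta>] pos'[OF that, of \<delta>] by (auto simp: complex_nonpos_Reals_iff)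
  have nz: "1 + w * exp (\<i> * of_real \<delta>) \<noteq> 0" "1 + w * exp (- (\<i> * of_real \<delta>)) \<noteq> 0"
    if "w \<in> \<Delta>" for w
    using pos[OF that, of \<delta>] pos'[OF that, of \<delta>] by (metis less_irrefl zero_complex.simps(1))+
  have "disc_log (\<lambda>w. (1 + w * exp (\<i> * of_real \<delta>)) / (1 + w * exp (- (\<i> * of_real \<delta>)))) z =
    Ln (1 + z * exp (\<i> * of_real \<delta>)) - Ln (1 + z * exp (- (\<i> * of_real \<delta>)))"
  proof (rule disc_log_unique[OF _ _ _ z])
    show "(\<lambda>z. Ln (1 + z * exp (\<i> * of_real \<delta>)) - Ln (1 + z * exp (- (\<i> * of_real \<delta>)))) holomorphic_on \<Delta>"
      by (intro holomorphic_intros np)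
  qed (use nz in \<open>auto simp: exp_diff\<close>)
  then show ?thesis by (simp add: B_fun_def)
qed

text \<open>In terms of u = sin \<delta> * B(z) the defining relation of B reads z sin (\<delta> - u) = sin u.
  Both logarithms have imaginary part in (-pi/2, pi/2), so |Re u| < pi/2, and |z| < 1 confines
  Re u to the strip.\<close>

lemma B_fun_strip:
  assumes \<delta>: "0 < \<delta>" "\<delta> < pi" and z: "z \<in> \<Delta>"
  shows "B_fun \<delta> z \<in> strip \<delta>"
    and "z * sin (of_real \<delta> - of_real (sin \<delta>) * B_fun \<delta> z) = sin (of_real (sin \<delta>) * B_fun \<delta> z)"
    and "strip_map \<delta> (B_fun \<delta> z) = z"
proof -
  have s: "0 < sin \<delta>" using \<delta> by (intro sin_gt_zero) auto
  define u where "u = of_real (sin \<delta>) * B_fun \<delta> z"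
  define X where "X = 1 + z * exp (\<i> * of_real \<delta>)"
  define Y where "Y = 1 + z * exp (- (\<i> * of_real \<delta>))"
  have u: "2 * \<i> * u = Ln X - Ln Y"
    using s by (simp add: u_def B_fun_eq[OF z] X_def Y_def)
  have "0 < Re X" using abs_Re_le_cmod[of "z * exp (\<i> * of_real \<delta>)"] z by (simp add: X_def norm_mult)
  moreover have "0 < Re Y"
    using abs_Re_le_cmod[of "z * exp (- (\<i> * of_real \<delta>))"] z
    by (simp add: Y_def norm_mult norm_exp_eq_Re)
  ultimately have im: "\<bar>Im (Ln X)\<bar> < pi / 2" "\<bar>Im (Ln Y)\<bar> < pi / 2" and nz: "X \<noteq> 0" "Y \<noteq> 0"
    using Re_Ln_pos_lt_imp by (blast, blast, auto)
  have "2 * Re u = Im (2 * \<i> * u)" by simp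
  also have "\<dots> = Im (Ln X) - Im (Ln Y)" unfolding u by simp
  finally have Reu: "\<bar>2 * Re u\<bar> < pi" using im by linarith
  have "exp (2 * \<i> * u) * Y = X" using nz by (simp add: u exp_diff)
  moreover have "exp (2 * \<i> * u) = exp (\<i> * u) * exp (\<i> * u)"
    by (simp flip: exp_add add: algebra_simps)
  ultimately have "exp (- (\<i> * u)) * (exp (\<i> * u) * exp (\<i> * u) * Y) = exp (- (\<i> * u)) * X" by simp
  then have "exp (\<i> * u) * Y = exp (- (\<i> * u)) * X" by (simp add: exp_minus field_simps)
  then have "exp (\<i> * u) - exp (- (\<i> * u)) =
    z * (exp (\<i> * (of_real \<delta> - u)) - exp (- (\<i> * (of_real \<delta> - u))))"
    by (simp add: X_def Y_def algebra_simps flip: exp_add)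
  then have eq: "z * sin (of_real \<delta> - u) = sin u" by (simp add: sin_exp_eq)
  then show *: "z * sin (of_real \<delta> - of_real (sin \<delta>) * B_fun \<delta> z) = sin (of_real (sin \<delta>) * B_fun \<delta> z)"
    by (simp add: u_def)
  \<comment> \<open>By the addition formula, sin u and sin (\<delta> - u) cannot vanish together,
    because sin \<delta> is nonzero.\<close>
  have nz: "sin (of_real \<delta> - u) \<noteq> 0"
  proof
    assume 0: "sin (of_real \<delta> - u) = 0"
    then have "sin u = 0" using eq by simp
    then have "cos u \<noteq> 0" using sin_cos_squared_add[of u] by auto
    then have "sin (of_real \<delta> :: complex) = 0"
      using 0 \<open>sin u = 0\<close> by (simp add: sin_diff)
    then show False using s by (simp add: sin_of_real)
  qed
  then show "strip_map \<delta> (B_fun \<delta> z) = z"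
    unfolding strip_map_def u_def[symmetric] by (simp flip: eq)
  have "norm (sin u) < norm (sin (of_real \<delta> - u))"
    using z nz by (simp flip: eq add: norm_mult)
  then have sp: "0 < sin (\<delta> - 2 * Re u)"
    using s unfolding norm_sin_less_iff by (simp add: zero_less_mult_iff)
  \<comment> \<open>|2 Re u| < pi places \<delta> - 2 Re u in (-pi, 2 pi), where a positive sine
    leaves only (0, pi).\<close>
  have "0 < \<delta> - 2 * Re u"
  proof (rule ccontr)
    assume "\<not> ?thesis"
    then have "0 \<le> sin (- (\<delta> - 2 * Re u))" by (intro sin_ge_zero) (use Reu \<delta> in auto)
    then show False using sp by (simp only: sin_minus)
  qed
  moreover have "\<delta> - 2 * Re u < pi"
  proof (rule ccontr)
    assume "\<not> ?thesis"
    then have "sin (\<delta> - 2 * Re u) \<le> 0" by (intro sin_le_zero) (use Reu \<delta> in auto)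
    then show False using sp by simp
  qed
  ultimately show "B_fun \<delta> z \<in> strip \<delta>"
    unfolding mem_strip_iff[OF s] u_def[symmetric] by auto
qed

text \<open>With v = \<delta> - u, the quotient is u sin v / (sin \<delta> sin u). Multiplying above
  and below by the conjugate of sin u makes the denominator positive and leaves
  \<open>strip_positivity\<close> at a = 2 Re u, b = 2 Im u.\<close>

lemma Re_B_fun_divide_pos:
  assumes \<delta>: "pi / 2 \<le> \<delta>" "\<delta> < pi" and z: "z \<in> \<Delta>" "z \<noteq> 0"
  shows "0 < Re (B_fun \<delta> z / z)"
proof -
  have \<delta>0: "0 < \<delta>" using \<delta> pi_gt_zero by linarith
  have s: "0 < sin \<delta>" using \<delta>0 \<delta> by (intro sin_gt_zero) auto
  define u where "u = of_real (sin \<delta>) * B_fun \<delta> z"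
  define v where "v = of_real \<delta> - u"
  note B = B_fun_strip[OF \<delta>0 \<delta>(2) z(1)]
  have zv: "z * sin v = sin u" using B(2) by (simp add: v_def u_def)
  have Reu: "\<delta> - pi < 2 * Re u" "2 * Re u < \<delta>" using B(1) unfolding mem_strip_iff[OF s] u_def by auto
  have su: "sin u \<noteq> 0"
    using norm_sin_less_strip[OF \<delta>0 \<delta>(2) B(1)] zv z(2) by (auto simp: v_def u_def)
  have "u \<noteq> 0" using su by auto
  then have ne: "2 * Re u \<noteq> 0 \<or> 2 * Im u \<noteq> 0" by (auto simp: complex_eq_iff)
  \<comment> \<open>Product-to-sum separates real and imaginary parts: v - cnj u is real, and v +
    cnj u has real part \<delta>.\<close>
  have "sin v * cnj (sin u) = (cos (v - cnj u) - cos (v + cnj u)) / 2"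
    by (simp add: cnj_sin sin_times_sin)
  moreover have "v - cnj u = of_real (\<delta> - 2 * Re u)" "v + cnj u = Complex \<delta> (- 2 * Im u)"
    by (auto simp: v_def complex_eq_iff)
  ultimately have prod: "sin v * cnj (sin u) =
      Complex ((cos (\<delta> - 2 * Re u) - cos \<delta> * cosh (2 * Im u)) / 2) (- sin \<delta> * sinh (2 * Im u) / 2)"
    by (auto simp: complex_eq_iff Re_cos Im_cos cosh_field_def sinh_field_def Re_divide Im_divide
        Re_sin Im_sin field_simps)
  have "0 < 2 * Re u * (cos (\<delta> - 2 * Re u) - cos \<delta> * cosh (2 * Im u)) + 2 * Im u * sinh (2 * Im u) * sin \<delta>"
    by (rule strip_positivity[OF \<delta> Reu ne])
  also have "\<dots> = 4 * Re (u * (sin v * cnj (sin u)))" unfolding prod by (simp add: field_simps)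
  finally have pos: "0 < Re (u * (sin v * cnj (sin u)))" by linarith
  have "B_fun \<delta> z / z = u * sin v / (of_real (sin \<delta>) * sin u)"
    using s su z(2) by (simp add: u_def[symmetric] flip: zv) (simp add: u_def)
  also have "\<dots> = u * (sin v * cnj (sin u)) / of_real (sin \<delta> * (norm (sin u))^2)"
    using su s by (simp only: of_real_mult complex_norm_square) simp
  finally show ?thesis using pos s su by (simp only: Re_divide_of_real) simp
qed

text \<open>Subtract the two logarithm series and use e^(i n \<delta>) - e^(-i n \<delta>) = 2 i sin
  (n \<delta>).\<close>

lemma B_fun_sums:
  assumes "0 < sin \<delta>" and z: "z \<in> \<Delta>"
  shows "(\<lambda>n. of_real (A_coeff \<delta> n) * z ^ n) sums B_fun \<delta> z"
proof -
  define e where "e = (\<lambda>t::real. exp (\<i> * of_real t))"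
  have ne: "norm (z * e t) < 1" for t using z by (simp add: e_def norm_mult)
  have "(\<lambda>n. ((-1) ^ Suc n / of_nat n * (z * e \<delta>) ^ n - (-1) ^ Suc n / of_nat n * (z * e (- \<delta>)) ^ n)
      / (2 * \<i> * of_real (sin \<delta>))) sums ((Ln (1 + z * e \<delta>) - Ln (1 + z * e (- \<delta>))) / (2 * \<i> * of_real (sin \<delta>)))"
    by (intro sums_divide sums_diff Ln_series ne)
  moreover have "((-1) ^ Suc n / of_nat n * (z * e \<delta>) ^ n - (-1) ^ Suc n / of_nat n * (z * e (- \<delta>)) ^ n)
      / (2 * \<i> * of_real (sin \<delta>)) = of_real (A_coeff \<delta> n) * z ^ n" for n
  \<comment> \<open>At n = 0 both sides are 0, since division by zero yields 0.\<close>
  proof (cases n)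
    case (Suc k)
    have pow: "e t ^ n = exp (\<i> * of_real (real n * t))" for t
      by (simp add: e_def exp_of_nat_mult[symmetric] algebra_simps)
    have "e \<delta> ^ n - e (- \<delta>) ^ n = 2 * \<i> * of_real (sin (real n * \<delta>))"
      unfolding pow by (simp only: sin_of_real[symmetric] sin_exp_eq) simp
    then have "(-1) ^ Suc n / of_nat n * (z * e \<delta>) ^ n - (-1) ^ Suc n / of_nat n * (z * e (- \<delta>)) ^ n
       = (-1) ^ Suc n / of_nat n * z ^ n * (2 * \<i> * of_real (sin (real n * \<delta>)))"
      by (simp only: power_mult_distrib right_diff_distrib[symmetric] mult.assoc)
    then show ?thesis using assms(1) Suc by (simp add: A_coeff_def)
  qed (simp add: A_coeff_def)
  ultimately show ?thesis using z by (simp add: e_def B_fun_eq)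
qed

section \<open>The integral \<open>B_tilde\<close> and its power series\<close>

text \<open>Termwise differentiation shows that the series \<open>q\<close> is a primitive of
  B(z)/z, extended by 1 at 0; hence the contour integral equals \<open>q\<close>, and both claims
  transfer.\<close>

lemma B_tilde_props:
  assumes \<delta>: "0 < \<delta>" "\<delta> < pi" and z: "z \<in> \<Delta>"
  shows "(\<lambda>n. of_real (A_coeff \<delta> (Suc n)) / of_nat (Suc n) * z ^ Suc n) sums B_tilde \<delta> z"
    and "(B_tilde \<delta> has_field_derivative (if z = 0 then 1 else B_fun \<delta> z / z)) (at z)"
proof -
  have s: "0 < sin \<delta>" using \<delta> by (intro sin_gt_zero) auto
  define c where "c = (\<lambda>n. of_real (A_coeff \<delta> n) / of_nat n :: complex)"
  define q where "q = (\<lambda>z. \<Sum>n. c n * z ^ n)"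
  have sm: "summable (\<lambda>n. c n * w ^ n)" if w: "norm w < 1" for w
  proof (rule summable_comparison_test')
    show "summable (\<lambda>n. 1 / sin \<delta> * norm w ^ n)"
      using w by (intro summable_mult summable_geometric) auto
    show "norm (c n * w ^ n) \<le> 1 / sin \<delta> * norm w ^ n" for n
    proof (cases "n = 0")
      case True
      then show ?thesis using s by (simp add: c_def)
    next
      case False
      \<comment> \<open>|c n| is |sin (n \<delta>)| / (n^2 sin \<delta>), so a geometric majorant
        suffices.\<close>
      have "\<bar>sin (real n * \<delta>)\<bar> \<le> 1 * 1" by simp
      also have "\<dots> \<le> real n * real n" using False by (intro mult_mono) auto
      finally have "\<bar>sin (real n * \<delta>)\<bar> \<le> real n * real n" .
      then have "norm (c n) \<le> 1 / sin \<delta>"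
        using False s by (simp add: c_def A_coeff_def norm_divide norm_mult norm_power abs_mult field_simps)
      then show ?thesis unfolding norm_mult norm_power by (rule mult_right_mono) simp
    qed
  qed
  have c0: "c 0 = 0" by (simp add: c_def)
  have q0: "q 0 = 0" using suminf_finite[of "{}" "\<lambda>n. c n * 0 ^ n"] c0
    by (simp add: q_def power_0_left if_distrib)
  have dq: "(q has_field_derivative (if w = 0 then 1 else B_fun \<delta> w / w)) (at w)"
    if w: "w \<in> \<Delta>" for w
  proof -
    have d: "(q has_field_derivative (\<Sum>n. diffs c n * w ^ n)) (at w)"
      unfolding q_def by (rule termdiffs_strong'[of 1]) (use sm w in auto)
    have diffs: "diffs c = (\<lambda>n. of_real (A_coeff \<delta> (Suc n)))"
      by (auto simp: diffs_def c_def simp del: of_nat_Suc)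
    have "(\<Sum>n. diffs c n * w ^ n) = (if w = 0 then 1 else B_fun \<delta> w / w)"
    proof (cases "w = 0")
      case True
      have "(\<lambda>n. diffs c n * 0 ^ n) sums diffs c 0" by (rule powser_sums_zero)
      then show ?thesis using True s by (simp add: sums_iff diffs A_coeff_def)
    next
      case False
      have "(\<lambda>n. of_real (A_coeff \<delta> (Suc n)) * w ^ Suc n) sums B_fun \<delta> w"
        using B_fun_sums[OF s w] by (subst sums_Suc_iff) (simp add: A_coeff_def)
      from sums_divide[OF this, of w] False show ?thesis by (simp add: diffs sums_iff)
    qed
    then show ?thesis using d by simp
  qed
  have eq: "B_tilde \<delta> w = q w" if w: "w \<in> \<Delta>" for w
  proof (cases "w = 0")
    case True
    then show ?thesis by (simp add: B_tilde_def q0)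
  next
    case False
    have "((\<lambda>w. if w = 0 then 1 else B_fun \<delta> w / w) has_contour_integral
        (q (pathfinish (linepath 0 w)) - q (pathstart (linepath 0 w)))) (linepath 0 w)"
    proof (rule contour_integral_primitive)
      show "(q has_field_derivative (if x = 0 then 1 else B_fun \<delta> x / x)) (at x within \<Delta>)"
        if "x \<in> \<Delta>" for x using dq[OF that] by (rule has_field_derivative_at_within)
      show "path_image (linepath 0 w) \<subseteq> \<Delta>" using w by (simp add: closed_segment_subset)
    qed (rule valid_path_linepath)
    then have "contour_integral (linepath 0 w) (\<lambda>w. if w = 0 then 1 else B_fun \<delta> w / w) = q w"
      by (simp add: contour_integral_unique q0)
    \<comment> \<open>The integrands differ only at 0, where B(t)/t evaluates to 0 instead of
      1.\<close>
    moreover have "contour_integral (linepath 0 w) (\<lambda>w. if w = 0 then 1 else B_fun \<delta> w / w) = B_tilde \<delta> w"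
      unfolding B_tilde_def
      by (rule contour_integral_spike_finite_simple_path[of "{0}"]) (use False in auto)
    ultimately show ?thesis by simp
  qed
  have "(\<lambda>n. c n * z ^ n) sums q z" unfolding q_def using sm z by (simp add: summable_sums)
  then have "(\<lambda>n. c (Suc n) * z ^ Suc n) sums q z" by (subst sums_Suc_iff) (simp add: c0)
  then show "(\<lambda>n. of_real (A_coeff \<delta> (Suc n)) / of_nat (Suc n) * z ^ Suc n) sums B_tilde \<delta> z"
    unfolding eq[OF z] c_def .
  show "(B_tilde \<delta> has_field_derivative (if z = 0 then 1 else B_fun \<delta> z / z)) (at z)"
    by (rule has_field_derivative_transform_within_open[OF dq[OF z] open_ball z]) (simp add: eq)
qed

section \<open>The class M and the conclusion\<close>

text \<open>Differentiating f(z) = z exp (L z) gives f' = exp (L z) (1 + z L'), so z f'/f - 1 = z L'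
  for z nonzero.\<close>

lemma class_M_log_derivative:
  assumes f: "f \<in> class_M \<delta>"
  shows "disc_log (quot_id f) holomorphic_on \<Delta>" "disc_log (quot_id f) 0 = 0"
    and "\<And>z. z \<in> \<Delta> \<Longrightarrow> z * deriv (disc_log (quot_id f)) z = log_deriv_quot f z - 1"
proof -
  have f1: "f holomorphic_on \<Delta>" "f 0 = 0" "deriv f 0 = 1" and nz: "\<And>z. z \<in> \<Delta> - {0} \<Longrightarrow> f z \<noteq> 0"
    using f by (auto simp: class_M_def class_A_def)
  \<comment> \<open>As a difference quotient at 0, \<open>quot_id f\<close> has its singularity
    removed by \<open>pole_lemma\<close>.\<close>
  have "quot_id f = (\<lambda>z. if z = 0 then deriv f 0 else (f z - f 0) / (z - 0))"
    using f1 by (auto simp: quot_id_def)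
  then have hol: "quot_id f holomorphic_on \<Delta>" using pole_lemma[OF f1(1), of 0] by simp
  have "quot_id f z \<noteq> 0" if "z \<in> \<Delta>" for z using nz[of z] that by (auto simp: quot_id_def)
  note L = disc_log_props[OF hol this]
  have q0: "quot_id f 0 = 1" by (simp add: quot_id_def)
  show 1: "disc_log (quot_id f) holomorphic_on \<Delta>" "disc_log (quot_id f) 0 = 0"
    using L(1,2)[OF _ q0] by auto
  show "z * deriv (disc_log (quot_id f)) z = log_deriv_quot f z - 1" if z: "z \<in> \<Delta>" for z
  proof (cases "z = 0")
    case False
    let ?L = "disc_log (quot_id f)"
    have ex: "z * exp (?L z) = f z" if "z \<in> \<Delta>" for z
      using L(3)[OF _ q0 that] f1(2) by (auto simp: quot_id_def[of f z])
    have "((\<lambda>z. z * exp (?L z)) has_field_derivative (exp (?L z) + z * (exp (?L z) * deriv ?L z))) (at z)"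
      using holomorphic_derivI[OF 1(1) open_ball z] by (auto intro!: derivative_eq_intros)
    then have "(f has_field_derivative (exp (?L z) + z * (exp (?L z) * deriv ?L z))) (at z)"
      by (rule has_field_derivative_transform_within_open[OF _ open_ball z]) (rule ex)
    then have "deriv f z = exp (?L z) * (1 + z * deriv ?L z)"
      by (simp add: DERIV_imp_deriv algebra_simps)
    then show ?thesis using False by (simp add: log_deriv_quot_def flip: ex[OF z])
  qed (simp add: log_deriv_quot_def)
qed

theorem theorem2p4:
  fixes \<delta> :: real
  assumes "pi / 2 \<le> \<delta>" and "\<delta> < pi"
  shows "(\<forall>f \<in> class_M \<delta>. disc_log (quot_id f) \<prec> B_tilde \<delta>) \<and>
    (\<forall>z \<in> \<Delta>. (\<lambda>n. of_real (A_coeff \<delta> (Suc n)) / of_nat (Suc n) * z ^ Suc n)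
                sums B_tilde \<delta> z) \<and>
    convex_univalent (B_tilde \<delta>)"
proof -
  have \<delta>: "0 < \<delta>" "\<delta> < pi" using assms pi_gt_zero by linarith+
  note S = convex_strip[of \<delta>] zero_mem_strip[OF \<delta>] strip_map_props[OF \<delta>]
  note dB = B_tilde_props(2)[OF \<delta>]
  have hol: "B_tilde \<delta> holomorphic_on \<Delta>"
    using dB holomorphic_on_open[OF open_ball] by blast
  have inj: "inj_on (B_tilde \<delta>) \<Delta>"
    by (rule Noshiro_Warschawski[OF convex_ball dB]) (use Re_B_fun_divide_pos[OF assms] in auto)
  have B0: "B_tilde \<delta> 0 = 0" by (simp add: B_tilde_def)
  \<comment> \<open>Needed for z = 0 in the next identity, where the left side is 0.\<close>
  have "B_fun \<delta> 0 = 0" by (simp add: B_fun_eq)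
  then have zdB: "z * deriv (B_tilde \<delta>) z = B_fun \<delta> z" if "z \<in> \<Delta>" for z
    using DERIV_imp_deriv[OF dB[OF that]] by simp
  have inv: "strip_map \<delta> (z * deriv (B_tilde \<delta>) z) = z" and mem: "z * deriv (B_tilde \<delta>) z \<in> strip \<delta>"
    if "z \<in> \<Delta>" for z
    using zdB[OF that] B_fun_strip[OF \<delta> that] by auto
  have "disc_log (quot_id f) \<prec> B_tilde \<delta>" if f: "f \<in> class_M \<delta>" for f
  proof (rule subordinate_of_log_derivative[OF S hol inj B0 inv])
    show "z * deriv (disc_log (quot_id f)) z \<in> strip \<delta>" if "z \<in> \<Delta>" for z
      using f that unfolding class_M_log_derivative(3)[OF f that]
      by (fastforce simp: class_M_def strip_def less_diff_eq diff_less_eq add.commute)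
  qed (use class_M_log_derivative[OF f] in auto)
  moreover have "convex (B_tilde \<delta> ` \<Delta>)"
    by (rule convex_image_of_log_derivative[OF S hol inj B0 inv mem])
  ultimately show ?thesis using B_tilde_props(1)[OF \<delta>] hol inj by (simp add: convex_univalent_def)
qed

end
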